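(* Let $k=4$ and $r_1\ge r_2\ge r_3\ge r_4\ge 1$. If $(r_1-1)\ge (r_2-1)+(r_3-1)+(r_4-1)$, then the arithmetic mean component competitive ratio for the 4-objective time series search problem is $$z_f^4=\frac18\left[\sqrt{4r_1+\{(r_2-1)+(r_3-1)+(r_4-1)\}^2}+(r_2+1)+(r_3+1)+(r_4+1)\right].$$
   Context: For an integer $k\ge 2$ and reals $0<m_i\le M_i$ ($1\le i\le k$), let $r_i=M_i/m_i$ be the fluctuation ratio of the price interval $[m_i,M_i]$ of the $i$th objective. It is assumed throughout that $r_1\ge\cdots\ge r_k\ge 1$. The arithmetic mean component competitive ratio of the $k$-objective time series search problem is the quantity $$z_f^k=\sup_{(x_1,\ldots,x_k)\in\mathcal{S}_f^k}\frac1k\left(\frac{M_1}{x_1}+\cdots+\frac{M_k}{x_k}\right),$$ where $$\mathcal{S}_f^k=\left\{(x_1,\ldots,x_k)\in[m_1,M_1]\times\cdots\times[m_k,M_k] : \frac1k\sum_{i=1}^k\frac{x_i}{m_i}=\frac1k\sum_{i=1}^k\frac{M_i}{x_i}\right\}.$$ *)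

theory Defs
  imports Complex_Main "HOL-Library.FuncSet"
begin

definition fluctuation_ratio :: "(nat \<Rightarrow> real) \<Rightarrow> (nat \<Rightarrow> real) \<Rightarrow> nat \<Rightarrow> real" where
  "fluctuation_ratio m M i = M i / m i"

text \<open>A \<open>k\<close>-tuple is a function on \<open>{1..k}\<close>, extended by \<open>undefined\<close> elsewhere (hence \<open>PiE\<close>).\<close>

definition S_f :: "nat \<Rightarrow> (nat \<Rightarrow> real) \<Rightarrow> (nat \<Rightarrow> real) \<Rightarrow> (nat \<Rightarrow> real) set" where
  "S_f k m M = {x \<in> (\<Pi>\<^sub>E i\<in>{1..k}. {m i..M i}).
     1 / real k * (\<Sum>i=1..k. x i / m i) = 1 / real k * (\<Sum>i=1..k. M i / x i)}"

text \<open>For \<open>0 < m i \<le> M i\<close> the supremum below is a genuine one: the set \<open>S_f k m M\<close> contains the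
  tuple with entries \<open>sqrt (m i * M i)\<close>, and every summand is at most \<open>M i / m i\<close>.\<close>

definition z_f :: "nat \<Rightarrow> (nat \<Rightarrow> real) \<Rightarrow> (nat \<Rightarrow> real) \<Rightarrow> real" where
  "z_f k m M = (SUP x\<in>S_f k m M. 1 / real k * (\<Sum>i=1..k. M i / x i))"

end

(* With t_i = x_i / m_i in [1, r_i] the constraint says that the sum of the t_i equals the sum of
   the r_i / t_i, so the objective is half the sum of all t_i + r_i / t_i. Each of these is at most
   r_i + 1. For i = 1 we use instead t_1 + r_1 / t_1 = sqrt (4 r_1 + d_1^2) with
   d_i = t_i - r_i / t_i: the constraint is d_1 = - (d_2 + ... + d_k), and |d_i| <= r_i - 1.
   Equality holds for t_i = 1 (i > 1), with t_1 the positive root of s - r_1 / s = sum (r_i - 1);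
   this root lies in [1, r_1] exactly because r_1 - 1 dominates that sum. *)
theory Submission imports Defs
begin

text \<open>The quadratic \<open>(t - 1) * (t - r)\<close> is nonpositive between its roots; divide
  by \<open>t\<close>.\<close>

lemma add_divide_le_add_one:
  fixes t r :: real
  assumes "1 \<le> t" "t \<le> r"
  shows "t + r / t \<le> r + 1"
proof -
  have "(t - 1) * (t - r) \<le> 0"
    using assms by (intro mult_nonneg_nonpos) auto
  then show ?thesis
    using assms by (simp add: field_simps)
qed

lemma abs_diff_divide_le:
  fixes t r :: real
  assumes "1 \<le> t" "t \<le> r"
  shows "\<bar>t - r / t\<bar> \<le> r - 1"
proof -
  have "r / t \<le> r" "1 \<le> r / t"
    using assms by (auto simp: field_simps)
  then show ?thesis using assms by linarith
qed

text \<open>The squares of \<open>t + r / t\<close> and \<open>t - r / t\<close> differ by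
  \<open>4 * r\<close>, and \<open>t + r / t\<close> is positive.\<close>

lemma add_divide_eq_sqrt:
  fixes t r :: real
  assumes "0 < t" "0 \<le> r"
  shows "t + r / t = sqrt (4 * r + (t - r / t)\<^sup>2)"
proof -
  have "4 * r + (t - r / t)\<^sup>2 = (t + r / t)\<^sup>2"
    using assms by (simp add: power2_eq_square field_simps)
  then show ?thesis using assms by simp
qed

lemma sum_ratio_le:
  fixes t r :: "nat \<Rightarrow> real"
  assumes k: "1 \<le> k"
    and t: "\<And>i. i \<in> {1..k} \<Longrightarrow> 1 \<le> t i \<and> t i \<le> r i"
    and balance: "(\<Sum>i=1..k. t i) = (\<Sum>i=1..k. r i / t i)"
  shows "(\<Sum>i=1..k. r i / t i) \<le>
    1 / 2 * (sqrt (4 * r 1 + (\<Sum>i=2..k. r i - 1)\<^sup>2) + (\<Sum>i=2..k. r i + 1))"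
proof -
  have split: "(\<Sum>i=1..k. f i) = f 1 + (\<Sum>i=2..k. f i)" for f :: "nat \<Rightarrow> real"
    using k by (simp add: sum.atLeast_Suc_atMost numeral_2_eq_2)
  have "t 1 - r 1 / t 1 = - (\<Sum>i=2..k. t i - r i / t i)"
    using balance split[of t] split[of "\<lambda>i. r i / t i"] by (simp add: sum_subtractf)
  also have "\<bar>\<dots>\<bar> \<le> (\<Sum>i=2..k. \<bar>t i - r i / t i\<bar>)"
    by simp
  also have "\<dots> \<le> (\<Sum>i=2..k. r i - 1)"
    using t by (intro sum_mono abs_diff_divide_le) auto
  finally have "(t 1 - r 1 / t 1)\<^sup>2 \<le> (\<Sum>i=2..k. r i - 1)\<^sup>2"
    by (simp add: abs_le_square_iff[symmetric])
  then have "t 1 + r 1 / t 1 \<le> sqrt (4 * r 1 + (\<Sum>i=2..k. r i - 1)\<^sup>2)"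
    using t[of 1] k by (subst add_divide_eq_sqrt) auto
  moreover have "(\<Sum>i=2..k. t i + r i / t i) \<le> (\<Sum>i=2..k. r i + 1)"
    using t by (intro sum_mono add_divide_le_add_one) auto
  moreover have "(\<Sum>i=1..k. r i / t i) = 1 / 2 * (\<Sum>i=1..k. t i + r i / t i)"
    using balance by (simp add: sum.distrib)
  ultimately show ?thesis
    using split[of "\<lambda>i. t i + r i / t i"] by simp
qed

text \<open>Here \<open>s\<close> is the positive root of the quadratic
  \<open>p(x) = x^2 - A * x - r\<close>. It lies between 1 and \<open>r\<close> because
  \<open>p(1) = 1 - A - r\<close> is nonpositive and \<open>p(r) = r * (r - 1 - A)\<close> is
  nonnegative.\<close>

lemma balanced_root:
  fixes r A :: real
  assumes "0 \<le> A" "A \<le> r - 1"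
  defines "s \<equiv> (A + sqrt (4 * r + A\<^sup>2)) / 2"
  shows "1 \<le> s" "s \<le> r" "s = r / s + A"
proof -
  have "2 - A \<le> sqrt (4 * r + A\<^sup>2)"
    using assms by (intro real_le_rsqrt) (simp add: power2_eq_square algebra_simps)
  then show "1 \<le> s" by (simp add: s_def)
  \<comment> \<open>Four times this product is \<open>(2 * r - A)^2 - (4 * r + A^2)\<close>.\<close>
  have "0 \<le> (r - 1 - A) * r"
    using assms by simp
  then have "sqrt (4 * r + A\<^sup>2) \<le> 2 * r - A"
    using assms by (intro real_le_lsqrt) (auto simp: power2_eq_square algebra_simps)
  then show "s \<le> r" by (simp add: s_def)
  have "2 * s - A = sqrt (4 * r + A\<^sup>2)"
    by (simp add: s_def field_simps)
  then have "(2 * s - A)\<^sup>2 = 4 * r + A\<^sup>2"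
    using assms(1,2) by simp
  then have "s * s = r + A * s"
    by (simp add: power2_eq_square algebra_simps)
  then show "s = r / s + A"
    using \<open>1 \<le> s\<close> by (simp add: field_simps)
qed

text \<open>\<open>sum_ratio_le\<close> bounds the objective from above, and
  \<open>balanced_root\<close> supplies a feasible point attaining the bound.\<close>

theorem z_f_eq_of_dominant_ratio:
  fixes m M r :: "nat \<Rightarrow> real"
  defines "r \<equiv> fluctuation_ratio m M"
  assumes k: "1 \<le> k"
    and mM: "\<And>i. i \<in> {1..k} \<Longrightarrow> 0 < m i \<and> m i \<le> M i"
    and dom: "(\<Sum>i=2..k. r i - 1) \<le> r 1 - 1"
  shows "z_f k m M = 1 / (2 * real k) *
    (sqrt (4 * r 1 + (\<Sum>i=2..k. r i - 1)\<^sup>2) + (\<Sum>i=2..k. r i + 1))"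
    (is "_ = 1 / (2 * real k) * ?B")
proof -
  define A where "A = (\<Sum>i=2..k. r i - 1)"
  define s where "s = (A + sqrt (4 * r 1 + A\<^sup>2)) / 2"
  have r1: "1 \<le> r i" if "i \<in> {1..k}" for i
    using mM[OF that] by (simp add: r_def fluctuation_ratio_def)
  have A: "0 \<le> A" "A \<le> r 1 - 1"
    using r1 dom by (auto simp: A_def intro!: sum_nonneg)
  note s = balanced_root[OF A, folded s_def]
  have split: "(\<Sum>i=1..k. f i) = f 1 + (\<Sum>i=2..k. f i)" for f :: "nat \<Rightarrow> real"
    using k by (simp add: sum.atLeast_Suc_atMost numeral_2_eq_2)
  \<comment> \<open>Adding the sum of ones to both sides of \<open>s = r 1 / s + A\<close> turns the
    root equation into the constraint defining \<open>S_f\<close>.\<close>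
  have A_split: "A + (\<Sum>i=2..k. 1) = (\<Sum>i=2..k. r i)"
    by (simp add: A_def sum_subtractf)
  \<comment> \<open>The maximizer: the first normalized price is \<open>s\<close>, all others are 1.
    \<open>restrict\<close> makes it \<open>undefined\<close> off \<open>{1..k}\<close>, as
    \<open>PiE\<close> demands.\<close>
  define x where "x = restrict (\<lambda>i. if i = 1 then m 1 * s else m i) {1..k}"
  have m1: "0 < m 1" using mM k by simp
  have M1: "M 1 = r 1 * m 1" using m1 by (simp add: r_def fluctuation_ratio_def)
  have "m 1 \<le> m 1 * s" "m 1 * s \<le> M 1"
    using s m1 unfolding M1 by (simp_all add: mult.commute)
  then have x_box: "x \<in> (\<Pi>\<^sub>E i\<in>{1..k}. {m i..M i})"
    using mM by (auto simp: x_def)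
  have "(\<Sum>i=1..k. x i / m i) = s + (\<Sum>i=2..k. x i / m i)"
    using m1 k by (simp only: split) (simp add: x_def)
  also have "(\<Sum>i=2..k. x i / m i) = (\<Sum>i=2..k. 1)"
  proof (rule sum.cong)
    fix i assume "i \<in> {2..k}"
    then show "x i / m i = 1" using mM[of i] by (auto simp: x_def)
  qed simp
  finally have x_sum: "(\<Sum>i=1..k. x i / m i) = s + (\<Sum>i=2..k. 1)" .
  have "(\<Sum>i=1..k. M i / x i) = r 1 / s + (\<Sum>i=2..k. M i / x i)"
    using m1 k by (simp only: split) (simp add: x_def M1 del: One_nat_def)
  also have "(\<Sum>i=2..k. M i / x i) = (\<Sum>i=2..k. r i)"
    by (rule sum.cong) (auto simp: x_def r_def fluctuation_ratio_def)
  finally have M_sum: "(\<Sum>i=1..k. M i / x i) = s + (\<Sum>i=2..k. 1)"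
    using A_split s(3) by linarith
  \<comment> \<open>\<open>2 * s\<close> is the square root plus \<open>A\<close>, and
    \<open>A\<close> plus twice the sum of ones is the sum of the \<open>r i + 1\<close>.\<close>
  have "?B = 2 * (s + (\<Sum>i=2..k. 1))"
    using A_split by (simp add: s_def sum.distrib field_simps flip: A_def)
  then have x_val: "1 / real k * (\<Sum>i=1..k. M i / x i) = 1 / (2 * real k) * ?B"
    unfolding M_sum by (simp del: distrib_left_numeral)
  have x_mem: "x \<in> S_f k m M"
    unfolding S_f_def using x_box by (simp only: mem_Collect_eq x_sum M_sum simp_thms)
  have bound: "1 / real k * (\<Sum>i=1..k. M i / y i) \<le> 1 / (2 * real k) * ?B"
    if y: "y \<in> S_f k m M" for y
  proof -
    define t where "t i = y i / m i" for i
    have y_box: "m i \<le> y i \<and> y i \<le> M i" if "i \<in> {1..k}" for i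
      using y that by (auto simp: S_f_def PiE_iff)
    have t: "1 \<le> t i \<and> t i \<le> r i" if "i \<in> {1..k}" for i
      using mM[OF that] y_box[OF that]
      by (simp add: t_def r_def fluctuation_ratio_def divide_right_mono)
    have rt: "(\<Sum>i=1..k. r i / t i) = (\<Sum>i=1..k. M i / y i)"
    proof (rule sum.cong)
      fix i assume "i \<in> {1..k}"
      then show "r i / t i = M i / y i"
        using mM[of i] by (simp add: t_def r_def fluctuation_ratio_def)
    qed simp
    have "(\<Sum>i=1..k. t i) = (\<Sum>i=1..k. r i / t i)"
      using y k unfolding rt by (simp add: S_f_def t_def)
    then have "(\<Sum>i=1..k. M i / y i) \<le> 1 / 2 * ?B"
      using sum_ratio_le[of k t r, OF k t] by (simp only: rt)
    from mult_left_mono[OF this, of "1 / real k"] show ?thesis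
      by simp
  qed
  show ?thesis
    unfolding z_f_def
  \<comment> \<open>The supremum is attained at \<open>x\<close>, so membership of the value and the
    upper bound suffice.\<close>
  proof (rule cSup_eq_maximum)
    show "1 / (2 * real k) * ?B \<in> (\<lambda>x. 1 / real k * (\<Sum>i=1..k. M i / x i)) ` S_f k m M"
      using x_mem x_val by (intro image_eqI[of _ _ x]) simp_all
  qed (use bound in blast)
qed

theorem theorem6p1:
  fixes m M r :: "nat \<Rightarrow> real"
  defines "r \<equiv> fluctuation_ratio m M"
  assumes "\<And>i. i \<in> {1..4} \<Longrightarrow> 0 < m i \<and> m i \<le> M i"
    and "r 1 \<ge> r 2" and "r 2 \<ge> r 3" and "r 3 \<ge> r 4" and "r 4 \<ge> 1"
    and "r 1 - 1 \<ge> (r 2 - 1) + (r 3 - 1) + (r 4 - 1)"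
  shows "z_f 4 m M =
    1 / 8 * (sqrt (4 * r 1 + ((r 2 - 1) + (r 3 - 1) + (r 4 - 1))\<^sup>2)
             + (r 2 + 1) + (r 3 + 1) + (r 4 + 1))"
proof -
  have sum_2_4: "(\<Sum>i=2..4. f i) = f 2 + f 3 + f 4" for f :: "nat \<Rightarrow> real"
    by (simp add: numeral_eq_Suc)
  have "(\<Sum>i=2..4. r i - 1) \<le> r 1 - 1"
    using assms(7) by (simp only: sum_2_4)
  from z_f_eq_of_dominant_ratio[of 4 m M, folded r_def, OF _ assms(2) this] show ?thesis
    by (simp add: sum_2_4 add.assoc)
qed

end
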